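(* Let $m,r_1,\ldots,r_m$ be positive integers, let $K$ be an algebraic number field, let $\omega_1,\ldots,\omega_m\in\mathbb{Q}$ with $0\le\omega_1<\cdots<\omega_m<1$, and let $n$ be a non-negative integer. For $1\le k\le r_1+\cdots+r_m$, let $(P_{k,i,j_i}(z))_{1\le i\le m,\,0\le j_i\le r_i-1}$ be the vector of polynomials defined in the context, and put $$\Delta(z)=\det\big(P_{k,i,j_i}(z)\big)_{\substack{1\le k\le r_1+\cdots+r_m\\ 1\le i\le m,\,0\le j_i\le r_i-1}}.$$ Then there exists $\gamma\in K\setminus\{0\}$ with $\Delta(z)=\gamma z^{(n+1)(r_1+\cdots+r_m)}$. In particular, $\Delta(\alpha)\ne0$ for every $\alpha\in K\setminus\{0\}$.
   Context: For $1\le k\le r_1+\cdots+r_m$ write $k=r_1+\cdots+r_u+s_{u+1}$ with $0\le u\le m-1$ and $1\le s_{u+1}\le r_{u+1}$ (where $r_1+\cdots+r_u=0$ if $u=0$). Put $$F_k(x)=\frac{1}{\prod_{i=1}^u\prod_{h=0}^{n+1}(x-\omega_i-h)^{r_i}}\cdot\frac{1}{(x-\omega_{u+1}-n-1)^{s_{u+1}}}\cdot\frac{1}{\prod_{i'=u+1}^m\prod_{h'=0}^{n}(x-\omega_{i'}-h')^{r_{i'}}},$$ and let $p_{k,h,i,j_i}(\boldsymbol{\omega})$ be the coefficients of its partial fraction decomposition $$F_k(x)=\sum_{i=1}^m\sum_{h=0}^{n+1}\sum_{j_i=1}^{r_i}\frac{p_{k,h,i,j_i}(\boldsymbol{\omega})}{(x-\omega_i-h)^{j_i}}.$$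 Then $$P_{k,i,j_i}(z)=\sum_{h=0}^{n+1}\frac{p_{k,h,i,j_i+1}(\boldsymbol{\omega})}{j_i!}(1+z)^h\qquad(1\le i\le m,\ 0\le j_i\le r_i-1).$$ In the determinant, rows are indexed by $k$ and columns by the pairs $(i,j_i)$ in lexicographic order. *)

theory Defs
  imports "Jordan_Normal_Form.Determinant"
begin

text \<open>The field \<open>K\<close> is a type of characteristic 0, finite-dimensional as a rational vector space.\<close>

definition number_field :: "'k::field_char_0 itself \<Rightarrow> bool" where
  "number_field _ \<longleftrightarrow>
     (\<exists>B :: 'k set. finite B \<and> module.span (\<lambda>q x. of_rat q * x) B = UNIV)"

lemma vector_space_of_rat:
  "vector_space (\<lambda>q (x :: 'k::field_char_0). of_rat q * x)"
  by unfold_locales (simp_all add: algebra_simps of_rat_add of_rat_mult)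

text \<open>
  The data are families \<open>r\<close> and \<open>\<omega>\<close> used at the indices \<open>1, \<dots>, m\<close>. A row index \<open>k\<close> with
  \<open>1 \<le> k \<le> r 1 + \<dots> + r m\<close> is written uniquely as \<open>k = r 1 + \<dots> + r u + s\<close> with
  \<open>u < m\<close> and \<open>1 \<le> s \<le> r (u + 1)\<close>.
\<close>

definition row_u :: "nat \<Rightarrow> (nat \<Rightarrow> nat) \<Rightarrow> nat \<Rightarrow> nat" where
  "row_u m r k =
     (THE u. u < m \<and> (\<exists>s. 1 \<le> s \<and> s \<le> r (u + 1) \<and> k = (\<Sum>i = 1..u. r i) + s))"

definition row_s :: "nat \<Rightarrow> (nat \<Rightarrow> nat) \<Rightarrow> nat \<Rightarrow> nat" where
  "row_s m r k = k - (\<Sum>i = 1..row_u m r k. r i)"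

definition F :: "nat \<Rightarrow> (nat \<Rightarrow> nat) \<Rightarrow> (nat \<Rightarrow> rat) \<Rightarrow> nat \<Rightarrow> nat \<Rightarrow> rat \<Rightarrow> rat" where
  "F m r \<omega> n k x =
     (let u = row_u m r k; s = row_s m r k in
        1 / (\<Prod>i = 1..u. \<Prod>h = 0..n + 1. (x - \<omega> i - of_nat h) ^ r i)
      * (1 / (x - \<omega> (u + 1) - of_nat n - 1) ^ s)
      * (1 / (\<Prod>i = u + 1..m. \<Prod>h = 0..n. (x - \<omega> i - of_nat h) ^ r i)))"

text \<open>
  \<open>p h i j\<close> is the coefficient of \<open>1 / (x - \<omega> i - h) ^ j\<close>. An identity of rational functions
  over the infinite field of rationals is the same as equality at all rational points that are
  not poles.
\<close>

definition partial_fractions ::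
  "nat \<Rightarrow> (nat \<Rightarrow> nat) \<Rightarrow> (nat \<Rightarrow> rat) \<Rightarrow> nat \<Rightarrow> nat \<Rightarrow> (nat \<Rightarrow> nat \<Rightarrow> nat \<Rightarrow> rat) \<Rightarrow> bool" where
  "partial_fractions m r \<omega> n k p \<longleftrightarrow>
     (\<forall>x. (\<forall>i\<in>{1..m}. \<forall>h\<in>{0..n + 1}. x \<noteq> \<omega> i + of_nat h) \<longrightarrow>
        F m r \<omega> n k x =
          (\<Sum>i = 1..m. \<Sum>h = 0..n + 1. \<Sum>j = 1..r i. p h i j / (x - \<omega> i - of_nat h) ^ j))"

text \<open>
  If \<open>0 \<le> \<omega> 1 < \<dots> < \<omega> m < 1\<close>, the points \<open>\<omega> i + h\<close> are pairwise distinct, so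
  the decomposition exists and its coefficients with \<open>1 \<le> i \<le> m\<close>, \<open>h \<le> n + 1\<close>,
  \<open>1 \<le> j \<le> r i\<close> are unique. Only these coefficients enter the definition of \<open>P\<close>; at other
  indices the choice is immaterial.
\<close>

definition pf_coeff ::
  "nat \<Rightarrow> (nat \<Rightarrow> nat) \<Rightarrow> (nat \<Rightarrow> rat) \<Rightarrow> nat \<Rightarrow> nat \<Rightarrow> nat \<Rightarrow> nat \<Rightarrow> nat \<Rightarrow> rat" where
  "pf_coeff m r \<omega> n k = (SOME p. partial_fractions m r \<omega> n k p)"

definition P ::
  "nat \<Rightarrow> (nat \<Rightarrow> nat) \<Rightarrow> (nat \<Rightarrow> rat) \<Rightarrow> nat \<Rightarrow> nat \<Rightarrow> nat \<Rightarrow> nat \<Rightarrow> 'k::field_char_0 poly" where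
  "P m r \<omega> n k i j =
     (\<Sum>h = 0..n + 1. smult (of_rat (pf_coeff m r \<omega> n k h i (j + 1)) / fact j) ([:1, 1:] ^ h))"

text \<open>The pairs \<open>(i, j)\<close> with \<open>1 \<le> i \<le> m\<close> and \<open>j < r i\<close>, in lexicographic order.\<close>

definition columns :: "nat \<Rightarrow> (nat \<Rightarrow> nat) \<Rightarrow> (nat \<times> nat) list" where
  "columns m r = [(i, j). i \<leftarrow> [1..<m + 1], j \<leftarrow> [0..<r i]]"

text \<open>Matrix indices start at 0, so row \<open>a\<close> belongs to \<open>k = a + 1\<close>.\<close>

definition \<Delta> :: "nat \<Rightarrow> (nat \<Rightarrow> nat) \<Rightarrow> (nat \<Rightarrow> rat) \<Rightarrow> nat \<Rightarrow> 'k::field_char_0 poly" where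
  "\<Delta> m r \<omega> n =
     (let N = (\<Sum>i = 1..m. r i) in
        det (mat N N (\<lambda>(a, b). case columns m r ! b of (i, j) \<Rightarrow> P m r \<omega> n (a + 1) i j)))"

end

theory Submission
  imports Defs "HOL-Computational_Algebra.Polynomial_FPS"
begin

text \<open>
  Substitute \<open>1 + z = exp t\<close>. Since \<open>t ^ j / j! * exp (a * t)\<close> is the Borel transform of
  \<open>1 / (x - a) ^ (j + 1)\<close>, the combination of the \<open>k\<close>-th row with the weights
  \<open>t ^ j * exp (\<omega> i * t)\<close> has as \<open>l\<close>-th coefficient, up to the factor \<open>1 / l!\<close>, the coefficient of
  \<open>1 / x ^ (l + 1)\<close> in the expansion of \<open>F k\<close> at infinity. With \<open>N = r 1 + \<dots> + r m\<close>, the denominator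
  of \<open>F k\<close> has degree \<open>(n + 1) * N + k\<close>, so these coefficients vanish for \<open>l < (n + 1) * N\<close>, and by
  Cramer's rule \<open>\<Delta>\<close> is divisible by \<open>z ^ ((n + 1) * N)\<close>. On the other hand the entries have degree at
  most \<open>n + 1\<close>, and the matrix of their coefficients of \<open>z ^ (n + 1)\<close> is lower triangular because
  \<open>F k\<close> has a pole of order exactly \<open>s\<close> at \<open>\<omega> (u + 1) + n + 1\<close> and none at \<open>\<omega> i + n + 1\<close> for
  \<open>i > u + 1\<close>.
\<close>

subsection \<open>Expansions of rational functions\<close>

text \<open>
  \<open>f\<close> agrees off a finite set with a rational function regular at 0 whose Taylor series is \<open>g\<close>;
  the values of \<open>f\<close> at poles are junk.
\<close>

definition has_expansion :: "('a::field_char_0 \<Rightarrow> 'a) \<Rightarrow> 'a fps \<Rightarrow> bool" where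
  "has_expansion f g \<longleftrightarrow> (\<exists>p q. coeff q 0 \<noteq> 0 \<and> finite {y. poly q y * f y \<noteq> poly p y}
     \<and> fps_of_poly q * g = fps_of_poly p)"

lemma has_expansionI:
  assumes "coeff q 0 \<noteq> 0" "finite {y. poly q y * f y \<noteq> poly p y}" "fps_of_poly q * g = fps_of_poly p"
  shows "has_expansion f g"
  using assms unfolding has_expansion_def by blast

lemma has_expansion_poly:
  assumes "\<And>y. f y = poly p y" "g = fps_of_poly p"
  shows "has_expansion f g"
  using assms by (intro has_expansionI[of 1 f p]) auto

lemma has_expansion_const: "has_expansion (\<lambda>_. c) (fps_const c)"
  by (rule has_expansion_poly[of _ "[:c:]"]) (auto simp: fps_of_poly_const)

lemma has_expansion_ident: "has_expansion (\<lambda>y. y) fps_X"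
  by (rule has_expansion_poly[of _ "[:0, 1:]"]) auto

lemma has_expansion_add_const: "has_expansion (\<lambda>y. y + c) (fps_X + fps_const c)"
  by (rule has_expansion_poly[of _ "[:c, 1:]"]) (auto simp: fps_of_poly_linear)

lemma has_expansion_one_minus: "has_expansion (\<lambda>y. 1 - c * y) (1 - fps_const c * fps_X)"
  by (rule has_expansion_poly[of _ "[:1, -c:]"]) (auto simp: fps_of_poly_linear' simp flip: fps_const_neg)

lemma has_expansion_add:
  assumes "has_expansion f g" "has_expansion f' g'"
  shows "has_expansion (\<lambda>y. f y + f' y) (g + g')"
proof -
  obtain p q where pq: "coeff q 0 \<noteq> 0" "finite {y. poly q y * f y \<noteq> poly p y}"
    "fps_of_poly q * g = fps_of_poly p" using assms(1) unfolding has_expansion_def by blast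
  obtain p' q' where pq': "coeff q' 0 \<noteq> 0" "finite {y. poly q' y * f' y \<noteq> poly p' y}"
    "fps_of_poly q' * g' = fps_of_poly p'" using assms(2) unfolding has_expansion_def by blast
  show ?thesis
  proof (rule has_expansionI[of "q * q'" _ "p * q' + p' * q"])
    show "finite {y. poly (q * q') y * (f y + f' y) \<noteq> poly (p * q' + p' * q) y}"
    proof (rule finite_subset[OF _ finite_UnI[OF pq(2) pq'(2)]], rule subsetI, rule ccontr)
      fix y assume y: "y \<in> {y. poly (q * q') y * (f y + f' y) \<noteq> poly (p * q' + p' * q) y}"
        "y \<notin> {y. poly q y * f y \<noteq> poly p y} \<union> {y. poly q' y * f' y \<noteq> poly p' y}"
      then have "poly p y = poly q y * f y" "poly p' y = poly q' y * f' y" by auto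
      with y(1) show False by (simp add: algebra_simps)
    qed
    show "fps_of_poly (q * q') * (g + g') = fps_of_poly (p * q' + p' * q)"
      by (simp add: fps_of_poly_mult fps_of_poly_add flip: pq(3) pq'(3)) (simp add: algebra_simps)
  qed (use pq pq' in \<open>simp add: coeff_mult\<close>)
qed

lemma has_expansion_mult:
  assumes "has_expansion f g" "has_expansion f' g'"
  shows "has_expansion (\<lambda>y. f y * f' y) (g * g')"
proof -
  obtain p q where pq: "coeff q 0 \<noteq> 0" "finite {y. poly q y * f y \<noteq> poly p y}"
    "fps_of_poly q * g = fps_of_poly p" using assms(1) unfolding has_expansion_def by blast
  obtain p' q' where pq': "coeff q' 0 \<noteq> 0" "finite {y. poly q' y * f' y \<noteq> poly p' y}"
    "fps_of_poly q' * g' = fps_of_poly p'" using assms(2) unfolding has_expansion_def by blast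
  show ?thesis
  proof (rule has_expansionI[of "q * q'" _ "p * p'"])
    show "finite {y. poly (q * q') y * (f y * f' y) \<noteq> poly (p * p') y}"
    proof (rule finite_subset[OF _ finite_UnI[OF pq(2) pq'(2)]], rule subsetI, rule ccontr)
      fix y assume y: "y \<in> {y. poly (q * q') y * (f y * f' y) \<noteq> poly (p * p') y}"
        "y \<notin> {y. poly q y * f y \<noteq> poly p y} \<union> {y. poly q' y * f' y \<noteq> poly p' y}"
      then have "poly p y = poly q y * f y" "poly p' y = poly q' y * f' y" by auto
      with y(1) show False by (simp add: algebra_simps)
    qed
    show "fps_of_poly (q * q') * (g * g') = fps_of_poly (p * p')"
      by (simp add: fps_of_poly_mult mult_ac flip: pq(3) pq'(3))
  qed (use pq pq' in \<open>simp add: coeff_mult\<close>)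
qed

text \<open>The roles of \<open>p\<close> and \<open>q\<close> are exchanged: \<open>g\<close> has a
  nonzero constant term, hence so has \<open>p\<close>. The finitely many zeros of \<open>p\<close>
  join the exceptional set, since \<open>1 / f y\<close> may be junk there.\<close>

lemma has_expansion_inverse:
  fixes f :: "'a::field_char_0 \<Rightarrow> 'a"
  assumes "has_expansion f g" "fps_nth g 0 \<noteq> 0"
  shows "has_expansion (\<lambda>y. 1 / f y) (inverse g)"
proof -
  obtain p q where pq: "coeff q 0 \<noteq> 0" "finite {y. poly q y * f y \<noteq> poly p y}"
    "fps_of_poly q * g = fps_of_poly p" using assms(1) unfolding has_expansion_def by blast
  have "coeff p 0 = fps_nth (fps_of_poly q * g) 0" by (simp add: pq(3))
  then have p0: "coeff p 0 \<noteq> 0" using pq(1) assms(2) by simp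
  then have "finite {y. poly p y = 0}" by (intro poly_roots_finite) auto
  show ?thesis
  proof (rule has_expansionI[OF p0])
    show "finite {y. poly p y * (1 / f y) \<noteq> poly q y}"
      by (rule finite_subset[OF _ finite_UnI[OF pq(2) \<open>finite {y. poly p y = 0}\<close>]])
        (auto simp: divide_simps mult.commute)
    have "fps_of_poly p * inverse g = fps_of_poly q * (inverse g * g)"
      by (simp add: mult_ac flip: pq(3))
    then show "fps_of_poly p * inverse g = fps_of_poly q"
      using inverse_mult_eq_1[OF assms(2)] by simp
  qed
qed

lemma has_expansion_sum:
  assumes "\<And>t. t \<in> T \<Longrightarrow> has_expansion (f t) (g t)"
  shows "has_expansion (\<lambda>y. \<Sum>t\<in>T. f t y) (\<Sum>t\<in>T. g t)"
  using assms
proof (induction T rule: infinite_finite_induct)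
  case (insert t T)
  then show ?case by (simp add: has_expansion_add)
qed (use has_expansion_const[of 0] in auto)

lemma has_expansion_prod:
  assumes "\<And>t. t \<in> T \<Longrightarrow> has_expansion (f t) (g t)"
  shows "has_expansion (\<lambda>y. \<Prod>t\<in>T. f t y) (\<Prod>t\<in>T. g t)"
  using assms
proof (induction T rule: infinite_finite_induct)
  case (insert t T)
  then show ?case by (simp add: has_expansion_mult)
qed (use has_expansion_const[of 1] in auto)

lemma has_expansion_power:
  assumes "has_expansion f g"
  shows "has_expansion (\<lambda>y. f y ^ e) (g ^ e)"
  using has_expansion_prod[of "{..<e}" "\<lambda>_. f" "\<lambda>_. g"] assms by simp

text \<open>Cross-multiplying, \<open>q' * p - q * p'\<close> vanishes at all but finitely many
  points of an infinite field, so it is the zero polynomial. Cancelling \<open>q\<close> and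
  \<open>q'\<close>, nonzero at 0, gives equal series. Identities of functions thereby become
  identities of power series.\<close>

lemma has_expansion_unique:
  fixes f :: "'a::field_char_0 \<Rightarrow> 'a"
  assumes "has_expansion f g" "has_expansion f' g'" "finite {y. f y \<noteq> f' y}"
  shows "g = g'"
proof -
  obtain p q where pq: "coeff q 0 \<noteq> 0" "finite {y. poly q y * f y \<noteq> poly p y}"
    "fps_of_poly q * g = fps_of_poly p" using assms(1) unfolding has_expansion_def by blast
  obtain p' q' where pq': "coeff q' 0 \<noteq> 0" "finite {y. poly q' y * f' y \<noteq> poly p' y}"
    "fps_of_poly q' * g' = fps_of_poly p'" using assms(2) unfolding has_expansion_def by blast
  have "finite {y. poly (q' * p - q * p') y \<noteq> 0}"
  proof (rule finite_subset[OF _ finite_UnI[OF assms(3) finite_UnI[OF pq(2) pq'(2)]]], rule subsetI)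
    fix y assume y: "y \<in> {y. poly (q' * p - q * p') y \<noteq> 0}"
    show "y \<in> {y. f y \<noteq> f' y} \<union> ({y. poly q y * f y \<noteq> poly p y} \<union> {y. poly q' y * f' y \<noteq> poly p' y})"
    proof (rule ccontr)
      assume "\<not> ?thesis"
      then have "f y = f' y" "poly q y * f y = poly p y" "poly q' y * f' y = poly p' y" by auto
      then have "poly q' y * poly p y = poly q y * poly p' y" by (metis mult.left_commute)
      with y show False by simp
    qed
  qed
  moreover have "{y. poly (q' * p - q * p') y = 0} \<union> {y. poly (q' * p - q * p') y \<noteq> 0} = UNIV"
    by blast
  ultimately have "infinite {y. poly (q' * p - q * p') y = 0}"
    using infinite_UNIV_char_0[where 'a = 'a] finite_Un by metis
  then have "q' * p - q * p' = 0" using poly_roots_finite by blast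
  then have "q' * p = q * p'" by simp
  then have "fps_of_poly q' * (fps_of_poly q * g) = fps_of_poly q * (fps_of_poly q' * g')"
    unfolding pq(3) pq'(3) by (simp flip: fps_of_poly_mult)
  moreover have "fps_of_poly q \<noteq> 0" "fps_of_poly q' \<noteq> 0"
    using pq(1) pq'(1) by (metis coeff_0 fps_of_poly_0 fps_of_poly_eq_iff)+
  ultimately show ?thesis by (simp add: mult.left_commute)
qed

subsection \<open>Partial fractions\<close>

text \<open>Induction on the total multiplicity, splitting products over two distinct poles.
  Exponents \<open>e t = 0\<close> are allowed, so one index set \<open>T\<close> serves throughout;
  a positive total makes the fraction proper.\<close>

lemma partial_fraction_exists:
  fixes a :: "'t \<Rightarrow> 'a::field" and e R :: "'t \<Rightarrow> nat"
  assumes T: "finite T" and inj: "inj_on a T" and eR: "\<And>t. t \<in> T \<Longrightarrow> e t \<le> R t"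
    and pos: "0 < (\<Sum>t\<in>T. e t)"
  shows "\<exists>c. \<forall>x. x \<notin> a ` T \<longrightarrow>
    1 / (\<Prod>t\<in>T. (x - a t) ^ e t) = (\<Sum>t\<in>T. \<Sum>j = 1..R t. c t j / (x - a t) ^ j)"
  using eR pos
proof (induction "\<Sum>t\<in>T. e t" arbitrary: e rule: less_induct)
  case less
  obtain b where b: "b \<in> T" "e b > 0"
    using less.prems(2) T by (metis not_gr0 sum.neutral)
  show ?case
  proof (cases "\<exists>d\<in>T. d \<noteq> b \<and> e d > 0")
    case False
    \<comment> \<open>Only \<open>b\<close> has a positive exponent: the fraction is a single power
      and is its own decomposition.\<close>
    define c where "c t j = (if t = b \<and> j = e b then 1 else 0 :: 'a)" for t j
    have "1 / (\<Prod>t\<in>T. (x - a t) ^ e t) = (\<Sum>t\<in>T. \<Sum>j = 1..R t. c t j / (x - a t) ^ j)" for x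
    proof -
      have "(\<Prod>t\<in>T. (x - a t) ^ e t) = (\<Prod>t\<in>T. if t = b then (x - a b) ^ e b else 1)"
        using False by (intro prod.cong) auto
      also have "\<dots> = (x - a b) ^ e b" using T b by simp
      finally have l: "(\<Prod>t\<in>T. (x - a t) ^ e t) = (x - a b) ^ e b" .
      have "(\<Sum>t\<in>T. \<Sum>j = 1..R t. c t j / (x - a t) ^ j) =
         (\<Sum>t\<in>T. if t = b then 1 / (x - a b) ^ e b else 0)"
      proof (intro sum.cong refl)
        fix t assume "t \<in> T"
        show "(\<Sum>j = 1..R t. c t j / (x - a t) ^ j) = (if t = b then 1 / (x - a b) ^ e b else 0)"
        proof (cases "t = b")
          case True
          then have "(\<Sum>j = 1..R t. c t j / (x - a t) ^ j) =
             (\<Sum>j = 1..R t. if j = e b then 1 / (x - a b) ^ e b else 0)"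
            by (intro sum.cong) (auto simp: c_def)
          then show ?thesis using True b less.prems(1)[of b] by simp
        qed (simp add: c_def)
      qed
      also have "\<dots> = 1 / (x - a b) ^ e b" using T b by simp
      finally show ?thesis using l by simp
    qed
    then show ?thesis by blast
  next
    case True
    then obtain d where d: "d \<in> T" "d \<noteq> b" "e d > 0" by blast
    have ab: "a b \<noteq> a d" using inj b d inj_onD[of a T b d] by auto
    have step: "\<exists>c. \<forall>x. x \<notin> a ` T \<longrightarrow>
       1 / (\<Prod>t\<in>T. (x - a t) ^ (e(s := e s - 1)) t) = (\<Sum>t\<in>T. \<Sum>j = 1..R t. c t j / (x - a t) ^ j)"
      if s: "s \<in> T" "e s > 0" "s' \<in> T" "e s' > 0" "s \<noteq> s'" for s s'
    proof (rule less.hyps)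
      have "(\<Sum>t\<in>T. e t) = e s + (\<Sum>t\<in>T - {s}. e t)"
        "(\<Sum>t\<in>T. (e(s := e s - 1)) t) = e s - 1 + (\<Sum>t\<in>T - {s}. e t)"
        using T s(1) by (simp_all add: sum.remove)
      \<comment> \<open>The second pole \<open>s'\<close> keeps the total positive after the
        exponent at \<open>s\<close> has dropped.\<close>
      moreover have "0 < (\<Sum>t\<in>T - {s}. e t)"
        using T s by (intro sum_pos2[of _ s']) auto
      ultimately show "(\<Sum>t\<in>T. (e(s := e s - 1)) t) < (\<Sum>t\<in>T. e t)"
         "0 < (\<Sum>t\<in>T. (e(s := e s - 1)) t)" using s by auto
      show "(e(s := e s - 1)) t \<le> R t" if "t \<in> T" for t using less.prems(1)[of t] less.prems(1)[of s] that by auto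
    qed
    obtain c1 where c1: "\<And>x. x \<notin> a ` T \<Longrightarrow>
       1 / (\<Prod>t\<in>T. (x - a t) ^ (e(b := e b - 1)) t) = (\<Sum>t\<in>T. \<Sum>j = 1..R t. c1 t j / (x - a t) ^ j)"
      using step[OF b d(1,3) d(2)[symmetric]] by blast
    obtain c2 where c2: "\<And>x. x \<notin> a ` T \<Longrightarrow>
       1 / (\<Prod>t\<in>T. (x - a t) ^ (e(d := e d - 1)) t) = (\<Sum>t\<in>T. \<Sum>j = 1..R t. c2 t j / (x - a t) ^ j)"
      using step[OF d(1,3) b d(2)] by blast
    \<comment> \<open>From \<open>(x - a d) - (x - a b) = a b - a d\<close>: dividing by the full
      product expresses its reciprocal through the two fractions with one factor fewer.\<close>
    define c where "c t j = (c2 t j - c1 t j) / (a b - a d)" for t j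
    have "1 / (\<Prod>t\<in>T. (x - a t) ^ e t) = (\<Sum>t\<in>T. \<Sum>j = 1..R t. c t j / (x - a t) ^ j)"
      if x: "x \<notin> a ` T" for x
    proof -
      have red: "(\<Prod>t\<in>T. (x - a t) ^ e t) = (x - a s) * (\<Prod>t\<in>T. (x - a t) ^ (e(s := e s - 1)) t)"
        if "s \<in> T" "e s > 0" for s
      proof -
        have "(\<Prod>t\<in>T. (x - a t) ^ e t) = (x - a s) ^ e s * (\<Prod>t\<in>T - {s}. (x - a t) ^ e t)"
          "(\<Prod>t\<in>T. (x - a t) ^ (e(s := e s - 1)) t) = (x - a s) ^ (e s - 1) * (\<Prod>t\<in>T - {s}. (x - a t) ^ e t)"
          using T that by (simp_all add: prod.remove)
        moreover have "(x - a s) ^ e s = (x - a s) * (x - a s) ^ (e s - 1)"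
          using that by (metis power_minus_mult mult.commute)
        ultimately show ?thesis by simp
      qed
      let ?L = "\<Prod>t\<in>T. (x - a t) ^ e t"
      have L: "?L \<noteq> 0" using T x by auto
      have quot: "1 / (\<Prod>t\<in>T. (x - a t) ^ (e(s := e s - 1)) t) = (x - a s) / ?L"
        if "s \<in> T" "e s > 0" for s
      proof -
        have "x - a s \<noteq> 0" using x that by auto
        then show ?thesis unfolding red[OF that] by simp
      qed
      have "(x - a d) / ?L - (x - a b) / ?L =
         (\<Sum>t\<in>T. \<Sum>j = 1..R t. (c2 t j - c1 t j) / (x - a t) ^ j)"
        using c1[OF x, unfolded quot[OF b]] c2[OF x, unfolded quot[OF d(1,3)]]
        by (simp add: sum_subtractf diff_divide_distrib)
      moreover have "(x - a d) / ?L - (x - a b) / ?L = (a b - a d) / ?L"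
        by (simp flip: diff_divide_distrib)
      ultimately have S: "(\<Sum>t\<in>T. \<Sum>j = 1..R t. (c2 t j - c1 t j) / (x - a t) ^ j) = (a b - a d) / ?L"
        by simp
      have "(\<Sum>t\<in>T. \<Sum>j = 1..R t. (c2 t j - c1 t j) / (x - a t) ^ j) / (a b - a d) = 1 / ?L"
        unfolding S using ab by simp
      moreover have "(\<Sum>t\<in>T. \<Sum>j = 1..R t. c t j / (x - a t) ^ j) =
          (\<Sum>t\<in>T. \<Sum>j = 1..R t. (c2 t j - c1 t j) / (x - a t) ^ j) / (a b - a d)"
        by (simp add: c_def sum_divide_distrib mult.commute)
      ultimately show ?thesis by simp
    qed
    then show ?thesis by blast
  qed
qed

section \<open>Principal parts and expansions at infinity\<close>

lemma fps_nth_prod_0: "fps_nth (\<Prod>t\<in>T. f t) 0 = (\<Prod>t\<in>T. fps_nth (f t) 0)"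
  by (induction T rule: infinite_finite_induct) auto

lemma fps_nth_X_power_mult_less: "l < q \<Longrightarrow> fps_nth (fps_X ^ q * g) l = 0"
  by (simp add: fps_X_power_mult_nth)

text \<open>The principal part at \<open>a b\<close> is read off the expansion of \<open>y ^ R b * f (a b + y)\<close>.\<close>

lemma partial_fraction_leading:
  fixes a :: "'t \<Rightarrow> 'a::field_char_0"
  assumes T: "finite T" and inj: "inj_on a T" and b: "b \<in> T" and eR: "e b \<le> R b"
    and eq: "\<And>x. x \<notin> a ` T \<Longrightarrow>
      1 / (\<Prod>t\<in>T. (x - a t) ^ e t) = (\<Sum>t\<in>T. \<Sum>j = 1..R t. c t j / (x - a t) ^ j)"
  shows "j \<in> {1..R b} \<Longrightarrow> e b < j \<Longrightarrow> c b j = 0" and "1 \<le> e b \<Longrightarrow> c b (e b) \<noteq> 0"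
proof -
  define u where "u t = fps_X + fps_const (a b - a t)" for t
  have u: "has_expansion (\<lambda>y. y + (a b - a t)) (u t)" for t
    unfolding u_def by (rule has_expansion_add_const)
  have u0: "fps_nth (u t) 0 \<noteq> 0" if "t \<in> T - {b}" for t
    using that b inj by (auto simp: u_def dest: inj_onD)
  \<comment> \<open>\<open>V\<close> is the unit part of the left side at \<open>a b\<close>. After
    multiplication by \<open>y ^ R b\<close>, the principal part at \<open>a b\<close> becomes the
    polynomial \<open>S\<close>, and the other poles contribute
    \<open>fps_X ^ R b * W\<close>.\<close>
  define V where "V = inverse (\<Prod>t\<in>T - {b}. u t ^ e t)"
  define W where "W = (\<Sum>t\<in>T - {b}. \<Sum>j = 1..R t. fps_const (c t j) * inverse (u t ^ j))"
  define S where "S = (\<Sum>j = 1..R b. fps_const (c b j) * fps_X ^ (R b - j))"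
  have V0: "fps_nth V 0 \<noteq> 0"
    using u0 T by (simp add: V_def fps_nth_prod_0 fps_power_zeroth)
  have "has_expansion (\<lambda>y. y ^ (R b - e b) * (1 / (\<Prod>t\<in>T - {b}. (y + (a b - a t)) ^ e t)))
     (fps_X ^ (R b - e b) * V)"
    unfolding V_def using u0 T
    by (intro has_expansion_mult has_expansion_power has_expansion_ident has_expansion_inverse
      has_expansion_prod u) (auto simp: fps_nth_prod_0 fps_power_zeroth)
  moreover have "has_expansion
     (\<lambda>y. (\<Sum>j = 1..R b. c b j * y ^ (R b - j)) +
          y ^ R b * (\<Sum>t\<in>T - {b}. \<Sum>j = 1..R t. c t j * (1 / (y + (a b - a t)) ^ j)))
     (S + fps_X ^ R b * W)"
    unfolding W_def S_def power_one_over[symmetric] fps_inverse_power using u0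
    by (intro has_expansion_add has_expansion_mult has_expansion_sum has_expansion_const
      has_expansion_power has_expansion_ident has_expansion_inverse u) auto
  ultimately have eqn: "fps_X ^ (R b - e b) * V = S + fps_X ^ R b * W"
  proof (rule has_expansion_unique)
    show "finite {y. y ^ (R b - e b) * (1 / (\<Prod>t\<in>T - {b}. (y + (a b - a t)) ^ e t)) \<noteq>
      (\<Sum>j = 1..R b. c b j * y ^ (R b - j)) +
          y ^ R b * (\<Sum>t\<in>T - {b}. \<Sum>j = 1..R t. c t j * (1 / (y + (a b - a t)) ^ j))}"
    proof (rule finite_subset[OF _ finite_imageI[OF T, of "\<lambda>t. a t - a b"]], rule subsetI, rule ccontr)
      fix y
      assume "y \<in> {y. y ^ (R b - e b) * (1 / (\<Prod>t\<in>T - {b}. (y + (a b - a t)) ^ e t)) \<noteq>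
      (\<Sum>j = 1..R b. c b j * y ^ (R b - j)) +
          y ^ R b * (\<Sum>t\<in>T - {b}. \<Sum>j = 1..R t. c t j * (1 / (y + (a b - a t)) ^ j))}"
      and y: "y \<notin> (\<lambda>t. a t - a b) ` T"
      moreover have "y + a b \<notin> a ` T" using y by (auto simp: image_iff eq_diff_eq)
      note eq[OF this]
      then have E: "y ^ R b * (1 / (y ^ e b * (\<Prod>t\<in>T - {b}. (y + (a b - a t)) ^ e t))) =
         y ^ R b * ((\<Sum>j = 1..R b. c b j / y ^ j) + (\<Sum>t\<in>T - {b}. \<Sum>j = 1..R t. c t j / (y + (a b - a t)) ^ j))"
        using T b by (simp add: prod.remove[of T b] sum.remove[of T b] add_diff_eq)
      have y0: "y \<noteq> 0" using y b by auto
      have "y ^ R b * (1 / (y ^ e b * (\<Prod>t\<in>T - {b}. (y + (a b - a t)) ^ e t))) =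
        y ^ (R b - e b) * (1 / (\<Prod>t\<in>T - {b}. (y + (a b - a t)) ^ e t))"
        using y0 eR by (simp add: power_diff)
      moreover have "y ^ R b * (\<Sum>j = 1..R b. c b j / y ^ j) = (\<Sum>j = 1..R b. c b j * y ^ (R b - j))"
        unfolding sum_distrib_left using y0 by (intro sum.cong) (auto simp: power_diff)
      ultimately show False using E by (simp add: distrib_left)
    qed
  qed
  \<comment> \<open>For \<open>j \<ge> 1\<close> the index \<open>R b - j\<close> is below
    \<open>R b\<close>, so the term with \<open>W\<close> is invisible there. The left side starts
    at \<open>R b - e b\<close>, that is at \<open>j = e b\<close>, with the coefficient
    \<open>V\<close> has at 0.\<close>
  have nth: "c b j = fps_nth (fps_X ^ (R b - e b) * V) (R b - j)" if "j \<in> {1..R b}" for j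
  proof -
    have "fps_nth S (R b - j) = (\<Sum>i = 1..R b. if i = j then c b j else 0)"
      unfolding S_def fps_sum_nth using that by (intro sum.cong) auto
    also have "\<dots> = c b j" using that by simp
    finally show ?thesis using that unfolding eqn by (simp add: fps_nth_X_power_mult_less)
  qed
  show "c b j = 0" if "j \<in> {1..R b}" "e b < j" 
    using nth[OF that(1)] that by (simp add: fps_nth_X_power_mult_less)
  show "c b (e b) \<noteq> 0" if "1 \<le> e b"
    using nth[of "e b"] that eR V0 by (simp add: fps_X_power_mult_nth)
qed

text \<open>With \<open>g j\<close> denoting the displayed series, Pascal's rule gives
  \<open>(1 - c X) * g (j + 1) = X * g j\<close>, and induction from the geometric series does the
  rest. Where \<open>l - j\<close> is truncated the binomial coefficient is 0.\<close>

lemma geometric_power_fps: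
  "(1 - fps_const c * fps_X) ^ Suc j * Abs_fps (\<lambda>l. of_nat (l choose j) * c ^ (l - j))
     = (fps_X ^ j :: 'a::field_char_0 fps)"
proof (induction j)
  case 0
  show ?case
    by (rule fps_ext) (auto simp: algebra_simps fps_X_mult_nth mult.assoc power_eq_if)
next
  case (Suc j)
  let ?g = "\<lambda>j. Abs_fps (\<lambda>l. of_nat (l choose j) * c ^ (l - j))"
  have "(1 - fps_const c * fps_X) * ?g (Suc j) = fps_X * ?g j"
  proof (rule fps_ext)
    fix l
    show "fps_nth ((1 - fps_const c * fps_X) * ?g (Suc j)) l = fps_nth (fps_X * ?g j) l"
    proof (cases l)
      case (Suc l')
      have "c * (of_nat (l' choose Suc j) * c ^ (l' - Suc j)) = of_nat (l' choose Suc j) * c ^ (l' - j)"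
        by (cases "l' > j") (auto simp: Suc_diff_Suc binomial_eq_0 simp flip: power_Suc)
      then have "fps_nth ((1 - fps_const c * fps_X) * ?g (Suc j)) l =
          of_nat (l choose Suc j) * c ^ (l - Suc j) - of_nat (l' choose Suc j) * c ^ (l' - j)"
        using Suc by (simp only: left_diff_distrib mult_1_left mult.assoc fps_sub_nth
          fps_mult_left_const_nth fps_X_mult_nth) simp
      then show ?thesis using Suc by (simp add: algebra_simps fps_X_mult_nth)
    qed (simp add: algebra_simps fps_X_mult_nth mult.assoc)
  qed
  then have "(1 - fps_const c * fps_X) ^ Suc j * ((1 - fps_const c * fps_X) * ?g (Suc j)) =
      fps_X * ((1 - fps_const c * fps_X) ^ Suc j * ?g j)"
    by (simp only: mult.left_commute)
  then show ?case unfolding Suc.IH by (simp only: power_Suc mult_ac)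
qed

text \<open>Expanding at infinity, in the variable \<open>y = 1 / x\<close>.\<close>

lemma partial_fraction_moments:
  fixes a :: "'t \<Rightarrow> 'a::field_char_0"
  assumes T: "finite T"
    and eq: "\<And>x. x \<notin> a ` T \<Longrightarrow>
      1 / (\<Prod>t\<in>T. (x - a t) ^ e t) = (\<Sum>t\<in>T. \<Sum>j = 1..R t. c t j / (x - a t) ^ j)"
    and l: "Suc l < (\<Sum>t\<in>T. e t)"
  shows "(\<Sum>t\<in>T. \<Sum>j<R t. c t (Suc j) * (of_nat (l choose j) * a t ^ (l - j))) = 0"
proof -
  define d where "d = (\<Sum>t\<in>T. e t)"
  define w where "w t = 1 - fps_const (a t) * fps_X" for t
  have w: "has_expansion (\<lambda>y. 1 - a t * y) (w t)" for t
    unfolding w_def by (rule has_expansion_one_minus)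
  have w0: "fps_nth (w t) 0 \<noteq> 0" for t by (simp add: w_def)
  define V where "V = inverse (\<Prod>t\<in>T. w t ^ e t)"
  define g where "g t j = Abs_fps (\<lambda>l. of_nat (l choose j) * a t ^ (l - j))" for t j
  have g: "g t j = fps_X ^ j * inverse (w t ^ Suc j)" for t j
  proof -
    have "w t ^ Suc j * g t j = fps_X ^ j"
      unfolding w_def g_def by (rule geometric_power_fps)
    then have "fps_X ^ j * inverse (w t ^ Suc j) = g t j * (inverse (w t ^ Suc j) * w t ^ Suc j)"
      by (metis mult.commute mult.left_commute)
    moreover have "fps_nth (w t ^ Suc j) 0 \<noteq> 0" using w0 by (simp add: fps_power_zeroth)
    ultimately show ?thesis by (metis inverse_mult_eq_1 mult_1_right)
  qed
  \<comment> \<open>With \<open>x = 1 / y\<close>, the reciprocal of the product is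
    \<open>y ^ d\<close> times a series with nonzero constant term, and every partial fraction has a
    factor \<open>y\<close>. Dividing both sides by \<open>y\<close> leaves the exponent
    \<open>d - 1\<close>.\<close>
  have "has_expansion (\<lambda>y. y ^ (d - 1) * (1 / (\<Prod>t\<in>T. (1 - a t * y) ^ e t))) (fps_X ^ (d - 1) * V)"
    unfolding V_def using w0
    by (intro has_expansion_mult has_expansion_power has_expansion_ident has_expansion_inverse
      has_expansion_prod w) (auto simp: fps_nth_prod_0 fps_power_zeroth T)
  moreover have "has_expansion
     (\<lambda>y. \<Sum>t\<in>T. \<Sum>j<R t. c t (Suc j) * (y ^ j * (1 / (1 - a t * y) ^ Suc j)))
     (\<Sum>t\<in>T. \<Sum>j<R t. fps_const (c t (Suc j)) * g t j)"
    unfolding g power_one_over[symmetric] fps_inverse_power using w0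
    by (intro has_expansion_mult has_expansion_sum has_expansion_const
      has_expansion_power has_expansion_ident has_expansion_inverse w) auto
  ultimately have eqn: "fps_X ^ (d - 1) * V = (\<Sum>t\<in>T. \<Sum>j<R t. fps_const (c t (Suc j)) * g t j)"
  proof (rule has_expansion_unique)
    show "finite {y. y ^ (d - 1) * (1 / (\<Prod>t\<in>T. (1 - a t * y) ^ e t)) \<noteq>
      (\<Sum>t\<in>T. \<Sum>j<R t. c t (Suc j) * (y ^ j * (1 / (1 - a t * y) ^ Suc j)))}"
    proof (rule finite_subset[of _ "insert 0 ((\<lambda>t. 1 / a t) ` T)"], rule subsetI, rule ccontr)
      fix y
      assume *: "y \<in> {y. y ^ (d - 1) * (1 / (\<Prod>t\<in>T. (1 - a t * y) ^ e t)) \<noteq>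
      (\<Sum>t\<in>T. \<Sum>j<R t. c t (Suc j) * (y ^ j * (1 / (1 - a t * y) ^ Suc j)))}"
      and y: "y \<notin> insert 0 ((\<lambda>t. 1 / a t) ` T)"
      then have y0: "y \<noteq> 0" by auto
      have "1 / y \<notin> a ` T"
      proof
        assume "1 / y \<in> a ` T"
        then obtain t where "t \<in> T" "a t = 1 / y" by force
        then have "1 / a t = y" by simp
        with \<open>t \<in> T\<close> y show False by blast
      qed
      note E = eq[OF this]
      have dif: "1 / y - a t = (1 - a t * y) / y" for t using y0 by (simp add: field_simps)
      have "y ^ (d - 1) * (1 / (\<Prod>t\<in>T. (1 - a t * y) ^ e t)) =
         (1 / y) * (1 / (\<Prod>t\<in>T. (1 / y - a t) ^ e t))"
      proof -
        have "(\<Prod>t\<in>T. (1 / y - a t) ^ e t) = (\<Prod>t\<in>T. (1 - a t * y) ^ e t) / y ^ d"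
          unfolding dif d_def by (simp add: power_divide prod_dividef power_sum)
        moreover have "y ^ d = y * y ^ (d - 1)" using l by (simp add: d_def flip: power_Suc)
        ultimately show ?thesis using y0 by simp
      qed
      moreover have "(\<Sum>t\<in>T. \<Sum>j<R t. c t (Suc j) * (y ^ j * (1 / (1 - a t * y) ^ Suc j))) =
         (1 / y) * (\<Sum>t\<in>T. \<Sum>j = 1..R t. c t j / (1 / y - a t) ^ j)"
        unfolding dif sum_distrib_left
        using y0 by (intro sum.cong refl sum.reindex_bij_witness[of _ "\<lambda>j. j - 1" Suc])
          (auto simp: power_divide)
      ultimately show False using E * by simp
    qed (use T in auto)
  qed
  have "fps_nth (fps_X ^ (d - 1) * V) l = 0"
    using l by (intro fps_nth_X_power_mult_less) (auto simp: d_def)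
  then show ?thesis unfolding eqn by (simp add: fps_sum_nth g_def)
qed

subsection \<open>Determinants of polynomial matrices\<close>

lemma coeff_mult_degree_le:
  assumes "degree p \<le> a" "degree q \<le> b"
  shows "coeff (p * q :: 'a::comm_semiring_0 poly) (a + b) = coeff p a * coeff q b"
proof -
  have "coeff p i * coeff q (a + b - i) = (if i = a then coeff p a * coeff q b else 0)" for i
    using assms by (cases i a rule: linorder_cases) (auto simp: coeff_eq_0)
  then show ?thesis by (simp add: coeff_mult)
qed

lemma coeff_prod_degree_le:
  assumes "\<And>i. i \<in> I \<Longrightarrow> degree (f i) \<le> d"
  shows "coeff (\<Prod>i\<in>I. f i :: 'a::comm_ring_1 poly) (d * card I) = (\<Prod>i\<in>I. coeff (f i) d)"
  using assms
proof (induction I rule: infinite_finite_induct)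
  case (insert i I)
  have "degree (\<Prod>i\<in>I. f i) \<le> (\<Sum>i\<in>I. degree (f i))" using degree_prod_sum_le insert by auto
  also have "\<dots> \<le> d * card I" using sum_bounded_above[of I "\<lambda>i. degree (f i)" d] insert by (simp add: mult.commute)
  finally have "coeff (f i * (\<Prod>i\<in>I. f i)) (d + d * card I) = coeff (f i) d * coeff (\<Prod>i\<in>I. f i) (d * card I)"
    using insert.prems by (intro coeff_mult_degree_le) auto
  then show ?case using insert by simp
qed auto

text \<open>Each product in the Leibniz formula has \<open>N\<close> factors of degree at most
  \<open>d\<close>, so its coefficient at \<open>d * N\<close> is the product of the coefficients at
  \<open>d\<close>.\<close>

lemma coeff_det_degree_le:
  fixes A :: "'a::comm_ring_1 poly mat"
  assumes A: "A \<in> carrier_mat N N" and deg: "\<And>i j. i < N \<Longrightarrow> j < N \<Longrightarrow> degree (A $$ (i, j)) \<le> d"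
  shows "coeff (det A) (d * N) = det (map_mat (\<lambda>p. coeff p d) A)"
proof -
  have "coeff (signof p * (\<Prod>i = 0..<N. A $$ (i, p i))) (d * N)
      = signof p * (\<Prod>i = 0..<N. map_mat (\<lambda>p. coeff p d) A $$ (i, p i))"
    if p: "p permutes {0..<N}" for p
  proof -
    have pi: "p i < N" if "i < N" for i using permutes_in_image[OF p, of i] that by simp
    have "coeff (\<Prod>i = 0..<N. A $$ (i, p i)) (d * card {0..<N}) = (\<Prod>i = 0..<N. coeff (A $$ (i, p i)) d)"
      by (rule coeff_prod_degree_le) (use deg pi in auto)
    also have "\<dots> = (\<Prod>i = 0..<N. map_mat (\<lambda>p. coeff p d) A $$ (i, p i))"
      using A pi by (intro prod.cong) auto
    finally show ?thesis by (simp add: sign_def)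
  qed
  then show ?thesis
    using A by (simp add: det_def'[of _ N] coeff_sum)
qed

text \<open>Cramer's rule without division: if some component of \<open>v\<close> is a unit, then \<open>det A\<close>
  inherits every common divisor of the entries of \<open>A v\<close>.\<close>

lemma dvd_det_of_mult_vec:
  fixes A :: "'a::comm_ring_1 mat"
  assumes A: "A \<in> carrier_mat N N" and b: "b < N" and unit: "v b dvd 1"
    and dvd: "\<And>k. k < N \<Longrightarrow> x dvd (\<Sum>c<N. A $$ (k, c) * v c)"
  shows "x dvd det A"
proof -
  let ?B = "adj_mat A"
  have B: "?B \<in> carrier_mat N N" and BA: "?B * A = det A \<cdot>\<^sub>m 1\<^sub>m N" using adj_mat[OF A] by auto
  have entry: "(\<Sum>k<N. ?B $$ (b, k) * A $$ (k, c)) = (if c = b then det A else 0)" if c: "c < N" for c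
  proof -
    have "(?B * A) $$ (b, c) = (\<Sum>k<N. ?B $$ (b, k) * A $$ (k, c))"
      using A B b c by (simp add: scalar_prod_def lessThan_atLeast0)
    then show ?thesis using b c unfolding BA by auto
  qed
  \<comment> \<open>Row \<open>b\<close> of \<open>adj A * (A v) = det A * v\<close> writes
    \<open>det A * v b\<close> as a combination of the entries of \<open>A v\<close>.\<close>
  have "(\<Sum>k<N. ?B $$ (b, k) * (\<Sum>c<N. A $$ (k, c) * v c)) =
      (\<Sum>c<N. (\<Sum>k<N. ?B $$ (b, k) * A $$ (k, c)) * v c)"
    by (simp add: sum_distrib_left sum_distrib_right mult.assoc) (rule sum.swap)
  also have "\<dots> = (\<Sum>c<N. if c = b then det A * v b else 0)"
    by (intro sum.cong) (auto simp: entry)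
  also have "\<dots> = det A * v b" using b by simp
  finally have "x dvd det A * v b" by (metis (no_types, lifting) dvd dvd_mult dvd_sum lessThan_iff)
  moreover obtain w where w: "1 = v b * w" using unit by (rule dvdE)
  ultimately have "x dvd det A * (v b * w)" by (metis dvd_mult2 mult.assoc)
  then show ?thesis by (simp flip: w)
qed

subsection \<open>Indexing of rows and columns\<close>

text \<open>The zero-based position of the first row, and of the first column, belonging to the
  index \<open>u + 1\<close>; \<open>block_start r m\<close> is the size of the matrix.\<close>

definition block_start :: "(nat \<Rightarrow> nat) \<Rightarrow> nat \<Rightarrow> nat" where
  "block_start r u = (\<Sum>i = 1..u. r i)"

lemma block_start_Suc [simp]: "block_start r (Suc u) = block_start r u + r (Suc u)"
  by (simp add: block_start_def)

lemma block_start_mono: "u \<le> v \<Longrightarrow> block_start r u \<le> block_start r v"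
  unfolding block_start_def by (intro sum_mono2) auto

lemma block_decomposition:
  assumes "b < block_start r m"
  shows "\<exists>u j. u < m \<and> j < r (Suc u) \<and> b = block_start r u + j"
  using assms
proof (induction m)
  case 0
  then show ?case by (simp add: block_start_def)
next
  case (Suc m)
  show ?case
  proof (cases "b < block_start r m")
    case True
    then show ?thesis using Suc.IH less_SucI by blast
  next
    case False
    then show ?thesis using Suc.prems by (intro exI[of _ m] exI[of _ "b - block_start r m"]) auto
  qed
qed

text \<open>If \<open>u'\<close> were smaller than \<open>u\<close>, its whole block would end
  before block \<open>u\<close> starts. This turns the order of matrix positions into the
  lexicographic order needed for triangularity.\<close>

lemma block_less:
  assumes "block_start r u + j < block_start r u' + j'" "j' < r (Suc u')"
  shows "u < u' \<or> u = u' \<and> j < j'"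
proof (rule ccontr)
  assume "\<not> ?thesis"
  then have "u' < u \<or> u = u' \<and> j' \<le> j" by auto
  then show False
  proof
    assume "u' < u"
    then have "block_start r (Suc u') \<le> block_start r u" by (intro block_start_mono) auto
    then show False using assms by simp
  qed (use assms in auto)
qed

lemma row_u_eq:
  assumes "u < m" "j < r (Suc u)"
  shows "row_u m r (Suc (block_start r u + j)) = u"
  unfolding row_u_def
proof (rule the_equality)
  show "u < m \<and> (\<exists>s\<ge>1. s \<le> r (u + 1) \<and> Suc (block_start r u + j) = (\<Sum>i = 1..u. r i) + s)"
    \<comment> \<open>The position \<open>j\<close> inside a block starts at 0, whereas
      \<open>s\<close> starts at 1.\<close>
    using assms by (intro conjI exI[of _ "Suc j"]) (auto simp: block_start_def)
  fix u' assume "u' < m \<and> (\<exists>s\<ge>1. s \<le> r (u' + 1) \<and> Suc (block_start r u + j) = (\<Sum>i = 1..u'. r i) + s)"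
  then obtain s where s: "1 \<le> s" "s \<le> r (Suc u')" "Suc (block_start r u + j) = block_start r u' + s"
    by (auto simp: block_start_def)
  then have e: "block_start r u + j = block_start r u' + (s - 1)" "s - 1 < r (Suc u')" by auto
  show "u' = u"
  proof (rule linorder_cases[of u u'])
    assume "u < u'"
    then have "block_start r (Suc u) \<le> block_start r u'" by (intro block_start_mono) auto
    then show ?thesis using e assms by simp
  next
    assume "u' < u"
    then have "block_start r (Suc u') \<le> block_start r u" by (intro block_start_mono) auto
    then show ?thesis using e assms by simp
  qed simp
qed

lemma row_s_eq:
  assumes "u < m" "j < r (Suc u)"
  shows "row_s m r (Suc (block_start r u + j)) = Suc j"
  using row_u_eq[of u m j r] assms by (simp add: row_s_def block_start_def)

lemma columns_Suc: "columns (Suc m) r = columns m r @ map (Pair (Suc m)) [0..<r (Suc m)]"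
  by (simp add: columns_def)

lemma length_columns: "length (columns m r) = block_start r m"
  by (induction m) (simp_all add: columns_Suc, simp add: columns_def block_start_def)

lemma nth_columns:
  assumes "u < m" "j < r (Suc u)"
  shows "columns m r ! (block_start r u + j) = (Suc u, j)"
  using assms
proof (induction m)
  case (Suc m)
  show ?case
  proof (cases "u < m")
    case True
    then have "block_start r (Suc u) \<le> block_start r m" by (intro block_start_mono) auto
    then show ?thesis using Suc True by (simp add: columns_Suc nth_append length_columns)
  next
    case False
    then have "u = m" using Suc.prems by simp
    then show ?thesis using Suc.prems by (simp add: columns_Suc nth_append length_columns)
  qed
qed simp

lemma sum_columns:
  "(\<Sum>b<block_start r m. g (columns m r ! b)) = (\<Sum>i = 1..m. \<Sum>j<r i. g (i, j))"
proof -
  have "(\<Sum>b<block_start r m. g (columns m r ! b)) = sum_list (map g (columns m r))"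
    by (simp add: sum_list_sum_nth length_columns lessThan_atLeast0)
  also have "\<dots> = (\<Sum>i = 1..m. \<Sum>j<r i. g (i, j))"
    by (induction m) (simp_all add: columns_Suc o_def interv_sum_list_conv_sum_set_nat lessThan_atLeast0,
       simp add: columns_def)
  finally show ?thesis .
qed

subsection \<open>The substitution of an exponential\<close>

lemma fps_X_power_dvdI:
  fixes f :: "'a::field fps"
  assumes "\<And>l. l < q \<Longrightarrow> fps_nth f l = 0"
  shows "fps_X ^ q dvd f"
proof (cases "f = 0")
  case False
  then have "q \<le> subdegree f" using assms by (intro subdegree_geI) auto
  then show ?thesis using False by (simp add: fps_dvd_iff)
qed simp

text \<open>The substitution \<open>z = exp t - 1\<close>. The inner series has no constant term, so
  composition is a ring homomorphism and commutes with determinants.\<close>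

definition exp_subst :: "'a::field_char_0 poly \<Rightarrow> 'a fps" where
  "exp_subst p = fps_of_poly p oo (fps_exp 1 - 1)"

lemma exp_subst_hom: "comm_ring_hom (exp_subst :: 'a::field_char_0 poly \<Rightarrow> 'a fps)"
  by unfold_locales
    (simp_all add: exp_subst_def fps_of_poly_add fps_of_poly_mult fps_compose_add_distrib
      fps_compose_mult_distrib)

lemma exp_subst_linear_power: "exp_subst ([:1, 1:] ^ h) = fps_exp (of_nat h :: 'a::field_char_0)"
proof -
  have "exp_subst [:1, 1 :: 'a:] = fps_exp 1"
    by (simp add: exp_subst_def fps_of_poly_linear fps_compose_add_distrib)
  moreover have "exp_subst ([:1, 1 :: 'a:] ^ h) = exp_subst [:1, 1:] ^ h"
    by (simp add: exp_subst_def fps_of_poly_power fps_compose_power)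
  ultimately show ?thesis by (simp add: fps_exp_power_mult)
qed

lemma exp_subst_smult: "exp_subst (smult c p) = fps_const c * exp_subst p"
  by (simp add: exp_subst_def fps_of_poly_smult fps_compose_mult_distrib)

lemma exp_subst_sum: "exp_subst (\<Sum>t\<in>T. f t) = (\<Sum>t\<in>T. exp_subst (f t))"
  by (simp add: exp_subst_def fps_of_poly_sum fps_compose_sum_distrib)

text \<open>\<open>exp t - 1\<close> has order exactly 1, so the order of vanishing at
  \<open>t = 0\<close> equals that of \<open>p\<close> at \<open>z = 0\<close>.\<close>

lemma coeff_eq_0_of_exp_subst_dvd:
  assumes "fps_X ^ q dvd exp_subst p" "l < q"
  shows "coeff p l = 0"
proof (cases "p = 0")
  case False
  have s: "subdegree (fps_exp 1 - 1 :: 'a fps) = 1" by (intro subdegreeI) auto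
  have "fps_of_poly p \<noteq> 0" using False by (metis fps_of_poly_0 fps_of_poly_eq_iff)
  then have "exp_subst p \<noteq> 0"
    unfolding exp_subst_def using s by (subst fps_compose_eq_0_iff) auto
  then have "q \<le> subdegree (exp_subst p)"
    using assms(1) dvd_imp_subdegree_le by fastforce
  also have "\<dots> = subdegree (fps_of_poly p)"
    unfolding exp_subst_def using s by simp
  finally have "fps_nth (fps_of_poly p) l = 0" using assms(2) by (intro nth_less_subdegree_zero) auto
  then show ?thesis by simp
qed simp

subsection \<open>The determinant\<close>

locale fractional_shifts =
  fixes m n :: nat and r :: "nat \<Rightarrow> nat" and \<omega> :: "nat \<Rightarrow> rat"
  assumes m_pos: "1 \<le> m"
    and r_pos: "\<And>i. i \<in> {1..m} \<Longrightarrow> 1 \<le> r i"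
    and omega_nonneg: "0 \<le> \<omega> 1"
    and omega_mono: "strict_mono_on {1..m} \<omega>"
    and omega_less: "\<omega> m < 1"
begin

section \<open>The poles of the rows and their orders\<close>

definition poles :: "(nat \<times> nat) set" where
  "poles = {1..m} \<times> {0..n + 1}"

definition pole :: "nat \<times> nat \<Rightarrow> rat" where
  "pole t = \<omega> (fst t) + of_nat (snd t)"

definition pole_mult :: "nat \<Rightarrow> nat \<Rightarrow> nat \<times> nat \<Rightarrow> nat" where
  "pole_mult u j t =
     (if snd t \<le> n \<or> fst t \<le> u then r (fst t) else if fst t = Suc u then Suc j else 0)"

definition row_index :: "nat \<Rightarrow> nat \<Rightarrow> nat" where
  "row_index u j = Suc (block_start r u + j)"

definition pf :: "nat \<Rightarrow> nat \<times> nat \<Rightarrow> nat \<Rightarrow> rat" where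
  "pf k t j = pf_coeff m r \<omega> n k (snd t) (fst t) j"

lemma finite_poles: "finite poles"
  by (simp add: poles_def)

lemma omega_bounds:
  assumes "i \<in> {1..m}"
  shows "0 \<le> \<omega> i" "\<omega> i < 1"
proof -
  have "\<omega> 1 \<le> \<omega> i" "\<omega> i \<le> \<omega> m"
    using assms strict_mono_on_imp_mono_on[OF omega_mono] by (auto simp: mono_on_def)
  then show "0 \<le> \<omega> i" "\<omega> i < 1" using omega_nonneg omega_less by auto
qed

text \<open>As \<open>0 \<le> \<omega> i < 1\<close>, the integer part of
  \<open>\<omega> i + h\<close> is \<open>h\<close>; the fractional part then determines
  \<open>i\<close> by strict monotonicity.\<close>

lemma inj_on_pole: "inj_on pole poles"
proof (rule inj_onI)
  fix t t' assume t: "t \<in> poles" and t': "t' \<in> poles" and eq: "pole t = pole t'"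
  have floor_pole: "\<lfloor>pole s\<rfloor> = int (snd s)" if "s \<in> poles" for s
    using omega_bounds[of "fst s"] that by (auto simp: pole_def poles_def floor_eq_iff)
  have "snd t = snd t'" using floor_pole[OF t] floor_pole[OF t'] eq by simp
  moreover from this have "\<omega> (fst t) = \<omega> (fst t')" using eq by (simp add: pole_def)
  then have "fst t = fst t'"
    using strict_mono_on_imp_inj_on[OF omega_mono] t t' by (auto simp: poles_def dest: inj_onD)
  ultimately show "t = t'" by (rule prod_eqI[rotated])
qed

lemma pole_mult_le: "t \<in> poles \<Longrightarrow> j < r (Suc u) \<Longrightarrow> pole_mult u j t \<le> r (fst t)"
  by (auto simp: pole_mult_def)

lemma F_row:
  assumes u: "u < m" and j: "j < r (Suc u)"
  shows "F m r \<omega> n (row_index u j) x = 1 / (\<Prod>t\<in>poles. (x - pole t) ^ pole_mult u j t)"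
proof -
  define g where "g i = (\<Prod>h = 0..n + 1. (x - \<omega> i - of_nat h) ^ pole_mult u j (i, h))" for i
  let ?G = "\<lambda>i. \<Prod>h = 0..n. (x - \<omega> i - of_nat h) ^ r i"
  let ?s = "(x - \<omega> (u + 1) - of_nat n - 1) ^ Suc j"
  have "(\<Prod>t\<in>poles. (x - pole t) ^ pole_mult u j t) = (\<Prod>i = 1..m. g i)"
    unfolding poles_def g_def by (subst prod.cartesian_product) (auto intro!: prod.cong simp: pole_def algebra_simps)
  also have "\<dots> = (\<Prod>i = 1..u. g i) * (\<Prod>i = u + 1..m. g i)"
    using prod.ub_add_nat[of 1 u g "m - u"] u by simp
  also have "(\<Prod>i = 1..u. g i) = (\<Prod>i = 1..u. \<Prod>h = 0..n + 1. (x - \<omega> i - of_nat h) ^ r i)"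
    unfolding g_def by (intro prod.cong) (auto simp: pole_mult_def)
  \<comment> \<open>For \<open>i > u\<close> the factor at \<open>h = n + 1\<close> is trivial
    except at \<open>i = u + 1\<close>, where it is the middle factor of \<open>F\<close>.\<close>
  also have "(\<Prod>i = u + 1..m. g i) = (\<Prod>i = u + 1..m. ?G i * (if i = u + 1 then ?s else 1))"
  proof (intro prod.cong refl)
    fix i assume i: "i \<in> {u + 1..m}"
    have "(\<Prod>h = 0..n. (x - \<omega> i - of_nat h) ^ pole_mult u j (i, h)) = ?G i"
      by (intro prod.cong) (auto simp: pole_mult_def)
    then show "g i = ?G i * (if i = u + 1 then ?s else 1)"
      using i by (auto simp: g_def pole_mult_def algebra_simps)
  qed
  also have "\<dots> = (\<Prod>i = u + 1..m. ?G i) * ?s"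
    using u by (simp add: prod.distrib)
  finally show ?thesis
    unfolding F_def row_index_def row_u_eq[of u m j r, OF u j] row_s_eq[of u m j r, OF u j] by (simp add: Let_def)
qed

text \<open>The coefficients come from a choice operator, so a decomposition must be exhibited; the
  pole \<open>(1, 0)\<close>, of order \<open>r 1\<close>, makes the total multiplicity positive.
  The later facts on \<open>pf\<close> are drawn from this identity.\<close>

lemma pf_row:
  assumes u: "u < m" and j: "j < r (Suc u)" and x: "x \<notin> pole ` poles"
  shows "1 / (\<Prod>t\<in>poles. (x - pole t) ^ pole_mult u j t) =
    (\<Sum>t\<in>poles. \<Sum>l = 1..r (fst t). pf (row_index u j) t l / (x - pole t) ^ l)"
proof -
  have iff: "partial_fractions m r \<omega> n (row_index u j) p \<longleftrightarrow> (\<forall>x. x \<notin> pole ` poles \<longrightarrow>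
      1 / (\<Prod>t\<in>poles. (x - pole t) ^ pole_mult u j t) =
      (\<Sum>t\<in>poles. \<Sum>l = 1..r (fst t). p (snd t) (fst t) l / (x - pole t) ^ l))" for p
  proof -
    have "(\<forall>i\<in>{1..m}. \<forall>h\<in>{0..n + 1}. x \<noteq> \<omega> i + of_nat h) \<longleftrightarrow> x \<notin> pole ` poles" for x
      by (auto simp: poles_def pole_def image_iff)
    moreover have "(\<Sum>i = 1..m. \<Sum>h = 0..n + 1. \<Sum>l = 1..r i. p h i l / (x - \<omega> i - of_nat h) ^ l) =
       (\<Sum>t\<in>poles. \<Sum>l = 1..r (fst t). p (snd t) (fst t) l / (x - pole t) ^ l)" for x
      unfolding poles_def by (subst sum.cartesian_product) (auto intro!: sum.cong simp: pole_def algebra_simps)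
    ultimately show ?thesis unfolding partial_fractions_def F_row[OF u j] by presburger
  qed
  have "(1, 0) \<in> poles" using m_pos by (simp add: poles_def)
  moreover have "0 < pole_mult u j (1, 0)" using r_pos[of 1] m_pos by (simp add: pole_mult_def)
  ultimately have "0 < (\<Sum>t\<in>poles. pole_mult u j t)"
    by (intro sum_pos2[OF finite_poles]) auto
  from partial_fraction_exists[OF finite_poles inj_on_pole pole_mult_le[OF _ j] this]
  obtain c where c: "\<And>x. x \<notin> pole ` poles \<Longrightarrow>
      1 / (\<Prod>t\<in>poles. (x - pole t) ^ pole_mult u j t) =
      (\<Sum>t\<in>poles. \<Sum>l = 1..r (fst t). c t l / (x - pole t) ^ l)" by blast
  have "partial_fractions m r \<omega> n (row_index u j) (\<lambda>h i. c (i, h))"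
    unfolding iff using c by simp
  then have "partial_fractions m r \<omega> n (row_index u j) (pf_coeff m r \<omega> n (row_index u j))"
    unfolding pf_coeff_def by (rule someI[of "partial_fractions m r \<omega> n (row_index u j)"])
  then show ?thesis unfolding iff pf_def using x by blast
qed

text \<open>At \<open>\<omega> i + n + 1\<close> the pole has order 0 if \<open>i > u + 1\<close>
  and order \<open>j + 1\<close> if \<open>i = u + 1\<close>. These coefficients give the entries
  above the diagonal.\<close>

lemma pf_top_eq_0:
  assumes "u < m" "j < r (Suc u)" and i: "i \<in> {1..m}" and l: "l < r i"
    and less: "u + 1 < i \<or> i = u + 1 \<and> j < l"
  shows "pf (row_index u j) (i, n + 1) (Suc l) = 0"
proof (rule partial_fraction_leading(1)[OF finite_poles inj_on_pole _ pole_mult_le[OF _ assms(2)] pf_row[OF assms(1,2)]])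
  show "(i, n + 1) \<in> poles" using i by (simp add: poles_def)
  then show "(i, n + 1) \<in> poles" .
  show "Suc l \<in> {1..r (fst (i, n + 1))}" using l by simp
  show "pole_mult u j (i, n + 1) < Suc l" using less by (auto simp: pole_mult_def)
qed

text \<open>The pole at \<open>\<omega> (u + 1) + n + 1\<close> has order exactly
  \<open>j + 1\<close>; this coefficient gives the diagonal entry.\<close>

lemma pf_top_neq_0:
  assumes u: "u < m" and j: "j < r (Suc u)"
  shows "pf (row_index u j) (Suc u, n + 1) (Suc j) \<noteq> 0"
proof -
  have t: "(Suc u, n + 1) \<in> poles" using u by (simp add: poles_def)
  have e: "pole_mult u j (Suc u, n + 1) = Suc j" by (simp add: pole_mult_def)
  show ?thesis
    using partial_fraction_leading(2)[OF finite_poles inj_on_pole t pole_mult_le[OF t j] pf_row[OF u j]]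
    unfolding e by simp
qed

text \<open>The poles with \<open>h \<le> n\<close> have total order
  \<open>(n + 1) * block_start r m\<close>, and the pole \<open>(u + 1, n + 1)\<close> adds at least
  1. Hence \<open>Suc l\<close> stays below the degree of the denominator.\<close>

lemma pf_moments:
  assumes u: "u < m" and j: "j < r (Suc u)" and l: "l < (n + 1) * block_start r m"
  shows "(\<Sum>t\<in>poles. \<Sum>q<r (fst t).
    pf (row_index u j) t (Suc q) * (of_nat (l choose q) * pole t ^ (l - q))) = 0"
proof (rule partial_fraction_moments[OF finite_poles pf_row[OF u j]])
  have "(\<Sum>t\<in>poles. pole_mult u j t) = (\<Sum>i = 1..m. \<Sum>h = 0..n + 1. pole_mult u j (i, h))"
    unfolding poles_def by (subst sum.cartesian_product) (auto intro!: sum.cong)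
  also have "\<dots> = (\<Sum>i = 1..m. (n + 1) * r i + pole_mult u j (i, n + 1))"
  proof (intro sum.cong refl)
    fix i
    have "(\<Sum>h = 0..n. pole_mult u j (i, h)) = (\<Sum>h = 0..n. r i)"
      by (intro sum.cong) (auto simp: pole_mult_def)
    then show "(\<Sum>h = 0..n + 1. pole_mult u j (i, h)) = (n + 1) * r i + pole_mult u j (i, n + 1)" by simp
  qed
  also have "\<dots> = (n + 1) * block_start r m + (\<Sum>i = 1..m. pole_mult u j (i, n + 1))"
    by (simp add: sum.distrib block_start_def sum_distrib_left)
  finally have "(\<Sum>t\<in>poles. pole_mult u j t) =
      (n + 1) * block_start r m + (\<Sum>i = 1..m. pole_mult u j (i, n + 1))" .
  moreover have "0 < (\<Sum>i = 1..m. pole_mult u j (i, n + 1))"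
    using u by (intro sum_pos2[of _ "Suc u"]) (auto simp: pole_mult_def)
  ultimately show "Suc l < (\<Sum>t\<in>poles. pole_mult u j t)" using l by linarith
qed

section \<open>The polynomials of a row and their exponential transforms\<close>

lemma P_eq: "P m r \<omega> n k i j =
    (\<Sum>h = 0..n + 1. smult (of_rat (pf k (i, h) (j + 1)) / fact j) ([:1, 1:] ^ h))"
  by (simp add: P_def pf_def)

lemma degree_P: "degree (P m r \<omega> n k i j) \<le> n + 1"
  unfolding P_eq
  by (intro degree_sum_le) (auto intro!: order_trans[OF degree_smult_le] simp: degree_linear_power)

lemma coeff_P: "coeff (P m r \<omega> n k i j) (n + 1) = of_rat (pf k (i, n + 1) (Suc j)) / fact j"
proof -
  have "coeff (P m r \<omega> n k i j) (n + 1) =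
     (\<Sum>h = 0..n + 1. if h = n + 1 then of_rat (pf k (i, n + 1) (Suc j)) / fact j else 0)"
    unfolding P_eq coeff_sum
    by (intro sum.cong) (auto simp: coeff_linear_power coeff_eq_0 degree_linear_power simp del: power_Suc)
  then show ?thesis by simp
qed

text \<open>The summand for \<open>h\<close> becomes a multiple of
  \<open>t ^ j / j! * exp (a * t)\<close> with \<open>a = pole (i, h)\<close>. Its coefficient
  \<open>a ^ (l - j) / (j! * (l - j)!)\<close> is \<open>(l choose j) * a ^ (l - j) / l!\<close>,
  and both forms are 0 for \<open>l < j\<close>.\<close>

lemma nth_exp_subst_P:
  "fps_nth (exp_subst (P m r \<omega> n k i j) * (fps_X ^ j * fps_exp (of_rat (\<omega> i)))) l =
    (of_rat (\<Sum>h = 0..n + 1. pf k (i, h) (Suc j) * (of_nat (l choose j) * pole (i, h) ^ (l - j)))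
      / fact l :: 'k::field_char_0)"
proof -
  have "exp_subst (P m r \<omega> n k i j) * (fps_X ^ j * fps_exp (of_rat (\<omega> i))) =
     (\<Sum>h = 0..n + 1. fps_const (of_rat (pf k (i, h) (j + 1)) / fact j :: 'k) *
        (fps_X ^ j * fps_exp (of_rat (pole (i, h)))))"
    unfolding P_eq exp_subst_sum exp_subst_smult exp_subst_linear_power sum_distrib_right pole_def
    by (intro sum.cong) (simp_all add: of_rat_add fps_exp_add_mult mult_ac)
  moreover have "(of_rat p / fact j * (if l < j then 0 else of_rat a ^ (l - j) / fact (l - j)) :: 'k) =
     of_rat (p * (of_nat (l choose j) * a ^ (l - j))) / fact l" for p a
    by (cases "l < j")
      (simp_all add: binomial_eq_0 of_rat_mult of_rat_power, simp add: binomial_fact)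
  ultimately show ?thesis
    by (simp add: fps_sum_nth fps_X_power_mult_nth of_rat_sum sum_divide_distrib
      del: sum.cl_ivl_Suc cong: if_cong)
qed

text \<open>Multiplied by \<open>l!\<close>, the coefficient of \<open>t ^ l\<close> is the moment
  sum of \<open>pf_moments\<close> with the summations over \<open>h\<close> and \<open>q\<close>
  exchanged.\<close>

lemma remainder_order:
  assumes u: "u < m" and j: "j < r (Suc u)"
  shows "fps_X ^ ((n + 1) * block_start r m) dvd
    (\<Sum>i = 1..m. \<Sum>q<r i. exp_subst (P m r \<omega> n (row_index u j) i q) *
        (fps_X ^ q * fps_exp (of_rat (\<omega> i) :: 'k::field_char_0)))"
proof (rule fps_X_power_dvdI)
  fix l assume l: "l < (n + 1) * block_start r m"
  let ?c = "\<lambda>i h q. pf (row_index u j) (i, h) (Suc q) * (of_nat (l choose q) * pole (i, h) ^ (l - q))"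
  have "(\<Sum>i = 1..m. \<Sum>q<r i. \<Sum>h = 0..n + 1. ?c i h q) = (\<Sum>i = 1..m. \<Sum>h = 0..n + 1. \<Sum>q<r i. ?c i h q)"
    by (intro sum.cong refl sum.swap)
  also have "\<dots> = (\<Sum>t\<in>poles. \<Sum>q<r (fst t).
      pf (row_index u j) t (Suc q) * (of_nat (l choose q) * pole t ^ (l - q)))"
    unfolding poles_def by (subst sum.cartesian_product) (auto intro!: sum.cong)
  also have "\<dots> = 0" by (rule pf_moments[OF u j l])
  finally have "(of_rat (\<Sum>i = 1..m. \<Sum>q<r i. \<Sum>h = 0..n + 1. ?c i h q) / fact l :: 'k) = 0" by simp
  then show "fps_nth (\<Sum>i = 1..m. \<Sum>q<r i. exp_subst (P m r \<omega> n (row_index u j) i q) *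
        (fps_X ^ q * fps_exp (of_rat (\<omega> i) :: 'k))) l = 0"
    unfolding fps_sum_nth nth_exp_subst_P by (simp only: of_rat_sum sum_divide_distrib)
qed

section \<open>The matrix of the polynomials and the order and degree of its determinant\<close>

definition coeff_mat :: "'k::field_char_0 poly mat" where
  "coeff_mat = mat (block_start r m) (block_start r m)
     (\<lambda>(a, b). case columns m r ! b of (i, j) \<Rightarrow> P m r \<omega> n (a + 1) i j)"

lemma coeff_mat_carrier: "coeff_mat \<in> carrier_mat (block_start r m) (block_start r m)"
  by (simp add: coeff_mat_def)

lemma dim_coeff_mat [simp]:
  "dim_row coeff_mat = block_start r m" "dim_col coeff_mat = block_start r m"
  by (simp_all add: coeff_mat_def)

lemma Delta_eq: "\<Delta> m r \<omega> n = det coeff_mat"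
  by (simp add: \<Delta>_def coeff_mat_def block_start_def Let_def)

lemma coeff_mat_index:
  "a < block_start r m \<Longrightarrow> b < block_start r m \<Longrightarrow>
    coeff_mat $$ (a, b) = P m r \<omega> n (Suc a) (fst (columns m r ! b)) (snd (columns m r ! b))"
  by (simp add: coeff_mat_def split_beta)

lemma coeff_Delta_neq_0:
  "coeff (\<Delta> m r \<omega> n :: 'k::field_char_0 poly) ((n + 1) * block_start r m) \<noteq> 0"
proof -
  let ?N = "block_start r m"
  let ?A = "map_mat (\<lambda>p. coeff p (n + 1)) coeff_mat :: 'k mat"
  have "coeff (\<Delta> m r \<omega> n :: 'k poly) ((n + 1) * ?N) = det ?A"
    unfolding Delta_eq
    by (rule coeff_det_degree_le[OF coeff_mat_carrier]) (simp add: coeff_mat_index degree_P del: One_nat_def)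
  \<comment> \<open>Rows and columns share the same block structure, so an entry above the diagonal
    lies in a later block or further on in the same block.\<close>
  also have "det ?A = prod_list (diag_mat ?A)"
  proof (rule det_lower_triangular)
    fix a b assume ab: "a < b" "b < ?N"
    obtain u j where uj: "u < m" "j < r (Suc u)" "a = block_start r u + j"
      using block_decomposition[of a r m] ab by auto
    obtain u' j' where uj': "u' < m" "j' < r (Suc u')" "b = block_start r u' + j'"
      using block_decomposition[of b r m] ab by auto
    have "u < u' \<or> u = u' \<and> j < j'"
      using block_less[of r u j u' j'] uj uj' ab by simp
    then have "pf (Suc a) (Suc u', n + 1) (Suc j') = 0"
      unfolding uj(3) row_index_def[symmetric] using uj uj' by (intro pf_top_eq_0) auto
    then show "?A $$ (a, b) = 0"
      using ab nth_columns[of u' m j' r] uj' coeff_mat_carrier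
      by (simp add: coeff_mat_index coeff_P[simplified])
  qed (use coeff_mat_carrier in auto)
  also have "\<dots> \<noteq> 0"
  proof -
    have "?A $$ (b, b) \<noteq> 0" if b: "b < ?N" for b
    proof -
      obtain u j where uj: "u < m" "j < r (Suc u)" "b = block_start r u + j"
        using block_decomposition[OF b] by auto
      have "pf (Suc b) (Suc u, n + 1) (Suc j) \<noteq> 0"
        using pf_top_neq_0[OF uj(1,2)] uj(3) by (simp add: row_index_def)
      then show ?thesis
        using b nth_columns[of u m j r] uj coeff_mat_carrier
        by (simp add: coeff_mat_index coeff_P[simplified])
    qed
    then show ?thesis using coeff_mat_carrier
      by (auto simp: prod_list_zero_iff diag_mat_def)
  qed
  finally show ?thesis .
qed

lemma coeff_Delta_less:
  assumes "l < (n + 1) * block_start r m"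
  shows "coeff (\<Delta> m r \<omega> n :: 'k::field_char_0 poly) l = 0"
proof (rule coeff_eq_0_of_exp_subst_dvd[OF _ assms])
  let ?N = "block_start r m"
  interpret hom: comm_ring_hom "exp_subst :: 'k poly \<Rightarrow> 'k fps" by (rule exp_subst_hom)
  have r1: "0 < r (Suc 0)" using r_pos[of 1] m_pos by simp
  \<comment> \<open>The weights of the remainder, listed in column order. The first is
    \<open>exp (\<omega> 1 * t)\<close>, whose constant term is 1, so it is the unit required by
    Cramer's rule.\<close>
  define v where "v b = (case columns m r ! b of (i, q) \<Rightarrow> fps_X ^ q * fps_exp (of_rat (\<omega> i) :: 'k))" for b
  have v0: "v 0 = fps_exp (of_rat (\<omega> 1))"
    using nth_columns[of 0 m 0 r] m_pos r1 by (simp add: v_def block_start_def)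
  have "fps_X ^ ((n + 1) * ?N) dvd det (map_mat exp_subst (coeff_mat :: 'k poly mat))"
  proof (rule dvd_det_of_mult_vec)
    show "map_mat exp_subst coeff_mat \<in> carrier_mat ?N ?N" using coeff_mat_carrier by simp
    show "0 < ?N" using block_start_mono[of 1 m r] m_pos r1 by (simp add: block_start_def)
    show "v 0 dvd 1" unfolding v0 by (simp add: fps_is_unit_iff)
    fix a assume a: "a < ?N"
    obtain u j where uj: "u < m" "j < r (Suc u)" "a = block_start r u + j"
      using block_decomposition[OF a] by auto
    have "(\<Sum>b<?N. map_mat exp_subst coeff_mat $$ (a, b) * v b) =
       (\<Sum>b<?N. (\<lambda>(i, q). exp_subst (P m r \<omega> n (row_index u j) i q) *
          (fps_X ^ q * fps_exp (of_rat (\<omega> i)))) (columns m r ! b))"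
      using a coeff_mat_carrier
      by (intro sum.cong) (auto simp: coeff_mat_index v_def row_index_def uj(3) split_beta)
    also have "\<dots> = (\<Sum>i = 1..m. \<Sum>q<r i. exp_subst (P m r \<omega> n (row_index u j) i q) *
          (fps_X ^ q * fps_exp (of_rat (\<omega> i))))"
      by (subst sum_columns) simp
    finally show "fps_X ^ ((n + 1) * ?N) dvd (\<Sum>b<?N. map_mat exp_subst coeff_mat $$ (a, b) * v b)"
      using remainder_order[OF uj(1,2)] by simp
  qed
  then show "fps_X ^ ((n + 1) * ?N) dvd exp_subst (\<Delta> m r \<omega> n :: 'k poly)"
    by (simp add: Delta_eq)
qed

text \<open>There are \<open>block_start r m\<close> rows of degree at most \<open>n + 1\<close>, so
  the degree bound meets the order of vanishing at 0 and only one coefficient is left.\<close>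

lemma Delta_monom:
  "\<exists>\<gamma>::'k::field_char_0. \<gamma> \<noteq> 0 \<and> \<Delta> m r \<omega> n = monom \<gamma> ((n + 1) * block_start r m)"
proof (intro exI conjI)
  let ?D = "(n + 1) * block_start r m"
  show "coeff (\<Delta> m r \<omega> n :: 'k poly) ?D \<noteq> 0" by (rule coeff_Delta_neq_0)
  have "degree (\<Delta> m r \<omega> n :: 'k poly) \<le> ?D"
    unfolding Delta_eq
    by (rule degree_det_le[OF _ coeff_mat_carrier]) (simp add: coeff_mat_index degree_P del: One_nat_def)
  then have "coeff (\<Delta> m r \<omega> n :: 'k poly) l = 0" if "l > ?D" for l
    using that by (intro coeff_eq_0) linarith
  then have "coeff (\<Delta> m r \<omega> n :: 'k poly) l = 0" if "l \<noteq> ?D" for l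
    using that coeff_Delta_less by (metis linorder_neqE_nat)
  then show "\<Delta> m r \<omega> n = monom (coeff (\<Delta> m r \<omega> n :: 'k poly) ?D) ?D"
    by (intro poly_eqI) (simp only: coeff_monom, metis)
qed

end

theorem corollary5p2:
  fixes m n :: nat and r :: "nat \<Rightarrow> nat" and \<omega> :: "nat \<Rightarrow> rat"
  assumes "number_field TYPE('k::field_char_0)"
    and "1 \<le> m"
    and "\<forall>i\<in>{1..m}. 1 \<le> r i"
    and "0 \<le> \<omega> 1"
    and "strict_mono_on {1..m} \<omega>"
    and "\<omega> m < 1"
  shows "(\<exists>\<gamma>::'k. \<gamma> \<noteq> 0 \<and> \<Delta> m r \<omega> n = monom \<gamma> ((n + 1) * (\<Sum>i = 1..m. r i)))
         \<and> (\<forall>\<alpha>::'k. \<alpha> \<noteq> 0 \<longrightarrow> poly (\<Delta> m r \<omega> n) \<alpha> \<noteq> 0)"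
proof -
  interpret fractional_shifts m n r \<omega> using assms by unfold_locales auto
  obtain \<gamma> :: 'k where "\<gamma> \<noteq> 0" "\<Delta> m r \<omega> n = monom \<gamma> ((n + 1) * (\<Sum>i = 1..m. r i))"
    using Delta_monom unfolding block_start_def by blast
  then show ?thesis by (auto simp: poly_monom)
qed

end
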